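(* Let $X$ be a non-compact Tychonoff space. The following are equivalent: (i) $X\models\mathsf S_1(\mathcal K,\mathcal K^{\mathrm{gp}})$. (ii) One does not have a winning strategy in $\mathsf G_1(\mathcal K_X,\mathcal K_X^{\mathrm{gp}})$. (iii) $C_k(X)$ is Reznichenko and has countable strong fan-tightness. (iv) $C_k(X)\models\mathsf S_1(\Omega_{C_k(X),\mathbf 0},\Omega^{\mathrm{gp}}_{C_k(X),\mathbf 0})$.
   Context: Tychonoff spaces are Hausdorff. For a set $Y$, $[Y]^\omega$ is the set of countably infinite subsets of $Y$. $K(X)$ is the set of non-empty compact subsets of $X$; $\mathscr T_X$ is the set of open $U\subseteq X$ with $U\neq\emptyset$ and $U\neq X$; $\mathcal K_X$ (the $k$-covers) is the set of all $\mathscr U\subseteq\mathscr T_X$ with $\bigcup\mathscr U=X$ such that every $K\in K(X)$ is contained in some $U\in\mathscr U$. $C_k(X)$ is the set of continuous real-valued functions on $X$ with the topology having as a basis the sets $[f;K,\varepsilon]=\{g:\sup\{|f(x)-g(x)|:x\in K\}<\varepsilon\}$ for $f$ continuous, $K\in K(X)$, $\varepsilon>0$. $\mathbf 0$ is the constant zero function. For a class $\mathfrak C$, $\mathscr C\in\mathfrak C$ is groupable if there is $\phi:\mathscr C\to\omega$ with every $\phi^{-1}(n)$ finite and with $\bigcup\{\phi^{-1}(n):n\in J\}\in\mathfrak C$ for every infinite $J\subseteq\omega$; $\mathfrak C^{\mathrm{gp}}$ is the set of groupable members of $\mathfrak C$. $\mathsf S_1(\mathcal A,\mathcal B)$: for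 every sequence $\langle\mathscr U_n:n\in\omega\rangle$ in $\mathcal A$ there are $A_n\in\mathscr U_n$ with $\{A_n:n\in\omega\}\in\mathcal B$. $X\models\mathsf S_1(\mathcal K,\mathcal K^{\mathrm{gp}})$ means $\mathsf S_1(\mathcal K_X,\mathcal K_X^{\mathrm{gp}})$ holds; $Z\models\mathsf S_1(\mathcal A,\mathcal B)$ for specific collections means the principle holds for these collections. In the game $\mathsf G_1(\mathcal A,\mathcal B)$, in inning $n\in\omega$ One plays $A_n\in\mathcal A$ and Two responds with $x_n\in A_n$; Two wins if $\{x_n:n\in\omega\}\in\mathcal B$, otherwise One wins. A strategy for One is a function $\sigma$ from finite sequences of elements of $\bigcup\mathcal A$ to $\mathcal A$; it is winning if whenever $x_n\in\sigma(\langle x_k:k<n\rangle)$ for all $n$, $\{x_n:n\in\omega\}\notin\mathcal B$. For a space $Z$ and $z\in Z$, $\Omega_{Z,z}=\{A\subseteq Z: z\in\mathrm{cl}(A)\setminus A\}$. $Z$ has countable strong fan-tightness if $\mathsf S_1(\Omega_{Z,z},\Omega_{Z,z})$ holds for every $z\in Z$. $Z$ is Reznichenko if $\Omega_{Z,z}\cap[Z]^\omega=\Omega_{Z,z}^{\mathrm{gp}}$ for every $z\in Z$. *)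

theory Defs
  imports "HOL-Analysis.Analysis"
begin

definition tychonoff_space :: "'a topology \<Rightarrow> bool" where
  "tychonoff_space X \<longleftrightarrow> completely_regular_space X \<and> Hausdorff_space X"


subsection \<open>Selection principles, groupability and games\<close>

definition S1 :: "'b set set \<Rightarrow> 'b set set \<Rightarrow> bool" where
  "S1 \<A> \<B> \<longleftrightarrow>
     (\<forall>\<U>::nat \<Rightarrow> 'b set. (\<forall>n. \<U> n \<in> \<A>) \<longrightarrow> (\<exists>a. (\<forall>n. a n \<in> \<U> n) \<and> range a \<in> \<B>))"

definition groupable :: "'b set set \<Rightarrow> 'b set \<Rightarrow> bool" where
  "groupable \<CC> \<C> \<longleftrightarrow>
     (\<exists>\<phi>::'b \<Rightarrow> nat. (\<forall>n. finite {c \<in> \<C>. \<phi> c = n}) \<and>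
        (\<forall>J. infinite J \<longrightarrow> (\<Union>n\<in>J. {c \<in> \<C>. \<phi> c = n}) \<in> \<CC>))"

definition gp :: "'b set set \<Rightarrow> 'b set set" where
  "gp \<CC> = {\<C> \<in> \<CC>. groupable \<CC> \<C>}"

text \<open>A strategy for One is total on lists; only its values on finite sequences of
  elements of \<open>\<Union>\<A>\<close> matter.\<close>

definition strategy_One :: "'b set set \<Rightarrow> ('b list \<Rightarrow> 'b set) \<Rightarrow> bool" where
  "strategy_One \<A> \<sigma> \<longleftrightarrow> (\<forall>s \<in> lists (\<Union>\<A>). \<sigma> s \<in> \<A>)"

definition winning_strategy_One ::
  "'b set set \<Rightarrow> 'b set set \<Rightarrow> ('b list \<Rightarrow> 'b set) \<Rightarrow> bool" where
  "winning_strategy_One \<A> \<B> \<sigma> \<longleftrightarrow>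
     strategy_One \<A> \<sigma> \<and>
     (\<forall>x::nat \<Rightarrow> 'b. (\<forall>n. x n \<in> \<sigma> (map x [0..<n])) \<longrightarrow> range x \<notin> \<B>)"


subsection \<open>\<open>k\<close>-covers\<close>

definition compacts :: "'a topology \<Rightarrow> 'a set set" where
  "compacts X = {K. K \<noteq> {} \<and> compactin X K}"

definition proper_opens :: "'a topology \<Rightarrow> 'a set set" where
  "proper_opens X = {U. openin X U \<and> U \<noteq> {} \<and> U \<noteq> topspace X}"

definition k_covers :: "'a topology \<Rightarrow> 'a set set set" where
  "k_covers X = {\<U>. \<U> \<subseteq> proper_opens X \<and> \<Union>\<U> = topspace X \<and>
                     (\<forall>K \<in> compacts X. \<exists>U \<in> \<U>. K \<subseteq> U)}"


subsection \<open>Tightness-type properties\<close>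

definition Omega :: "'b topology \<Rightarrow> 'b \<Rightarrow> 'b set set" where
  "Omega Z z = {A. A \<subseteq> topspace Z \<and> z \<in> Z closure_of A - A}"

definition countable_strong_fan_tightness :: "'b topology \<Rightarrow> bool" where
  "countable_strong_fan_tightness Z \<longleftrightarrow> (\<forall>z \<in> topspace Z. S1 (Omega Z z) (Omega Z z))"

definition Reznichenko :: "'b topology \<Rightarrow> bool" where
  "Reznichenko Z \<longleftrightarrow>
     (\<forall>z \<in> topspace Z.
        Omega Z z \<inter> {A. A \<subseteq> topspace Z \<and> countable A \<and> infinite A} = gp (Omega Z z))"


subsection \<open>The space of continuous functions with the compact-open topology\<close>

text \<open>Continuous functions on \<open>X\<close> are represented by functions that are \<open>undefined\<close> off
  the carrier, so that two of them are equal iff they agree on \<open>topspace X\<close>.\<close>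

definition cfuns :: "'a topology \<Rightarrow> ('a \<Rightarrow> real) set" where
  "cfuns X = {f \<in> extensional (topspace X). continuous_map X euclideanreal f}"

definition zero_fun :: "'a topology \<Rightarrow> 'a \<Rightarrow> real" where
  "zero_fun X = (\<lambda>x\<in>topspace X. 0)"

definition ck_basic :: "'a topology \<Rightarrow> ('a \<Rightarrow> real) \<Rightarrow> 'a set \<Rightarrow> real \<Rightarrow> ('a \<Rightarrow> real) set" where
  "ck_basic X f K \<epsilon> = {g \<in> cfuns X. (SUP x\<in>K. \<bar>f x - g x\<bar>) < \<epsilon>}"

definition ck_basis :: "'a topology \<Rightarrow> ('a \<Rightarrow> real) set set" where
  "ck_basis X = {ck_basic X f K \<epsilon> | f K \<epsilon>. f \<in> cfuns X \<and> K \<in> compacts X \<and> \<epsilon> > 0}"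

text \<open>If \<open>topspace X\<close> is empty then so is the basis, and the one-point set \<open>cfuns X\<close> is not
  recovered as the carrier; lemma \<open>topspace_Ck\<close> below covers all other cases.\<close>

definition Ck :: "'a topology \<Rightarrow> ('a \<Rightarrow> real) topology" where
  "Ck X = topology (arbitrary union_of (\<lambda>B. B \<in> ck_basis X))"

lemma bdd_above_cfuns_diff:
  assumes "f \<in> cfuns X" "g \<in> cfuns X" "K \<in> compacts X"
  shows "bdd_above ((\<lambda>x. \<bar>f x - g x\<bar>) ` K)"
proof -
  have "continuous_map X euclideanreal (\<lambda>x. \<bar>f x - g x\<bar>)"
    using assms by (intro continuous_intros) (auto simp: cfuns_def)
  then have "compactin euclideanreal ((\<lambda>x. \<bar>f x - g x\<bar>) ` K)"
    using assms image_compactin by (fastforce simp: compacts_def)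
  then show ?thesis
    by (simp add: bounded_imp_bdd_above compact_imp_bounded)
qed

lemma ck_basic_refine:
  assumes f: "f \<in> cfuns X" and K: "K \<in> compacts X" and g: "g \<in> ck_basic X f K \<epsilon>"
  shows "\<exists>\<delta>>0. ck_basic X g K \<delta> \<subseteq> ck_basic X f K \<epsilon>"
proof (intro exI conjI subsetI)
  let ?s = "SUP x\<in>K. \<bar>f x - g x\<bar>"
  have gc: "g \<in> cfuns X" and s: "?s < \<epsilon>"
    using g by (auto simp: ck_basic_def)
  show "\<epsilon> - ?s > 0" using s by simp
  fix h assume h: "h \<in> ck_basic X g K (\<epsilon> - ?s)"
  let ?t = "SUP x\<in>K. \<bar>g x - h x\<bar>"
  have hc: "h \<in> cfuns X" and t: "?t < \<epsilon> - ?s"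
    using h by (auto simp: ck_basic_def)
  have "(SUP x\<in>K. \<bar>f x - h x\<bar>) \<le> ?s + ?t"
  proof (rule cSUP_least)
    show "K \<noteq> {}" using K by (simp add: compacts_def)
    fix x assume x: "x \<in> K"
    have "\<bar>f x - g x\<bar> \<le> ?s" "\<bar>g x - h x\<bar> \<le> ?t"
      using x bdd_above_cfuns_diff[OF f gc K] bdd_above_cfuns_diff[OF gc hc K]
      by (auto intro: cSUP_upper)
    then show "\<bar>f x - h x\<bar> \<le> ?s + ?t" by linarith
  qed
  then show "h \<in> ck_basic X f K \<epsilon>"
    using t hc by (simp add: ck_basic_def)
qed

lemma ck_basic_antimono:
  assumes "f \<in> cfuns X" "K \<in> compacts X" "L \<in> compacts X" "K \<subseteq> L" "\<delta> \<le> \<epsilon>"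
  shows "ck_basic X f L \<delta> \<subseteq> ck_basic X f K \<epsilon>"
proof
  fix g assume g: "g \<in> ck_basic X f L \<delta>"
  then have "(SUP x\<in>K. \<bar>f x - g x\<bar>) \<le> (SUP x\<in>L. \<bar>f x - g x\<bar>)"
    using assms bdd_above_cfuns_diff[of f X g L]
    by (intro cSUP_subset_mono) (auto simp: ck_basic_def compacts_def)
  then show "g \<in> ck_basic X f K \<epsilon>"
    using g assms by (auto simp: ck_basic_def)
qed

lemma ck_basic_self:
  assumes "f \<in> cfuns X" "K \<in> compacts X" "\<epsilon> > 0"
  shows "f \<in> ck_basic X f K \<epsilon>"
  using assms by (auto simp: ck_basic_def compacts_def)

lemma istopology_Ck: "istopology (arbitrary union_of (\<lambda>B. B \<in> ck_basis X))"
proof -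
  have "\<exists>B \<in> ck_basis X. g \<in> B \<and> B \<subseteq> S \<inter> T"
    if S: "S \<in> ck_basis X" and T: "T \<in> ck_basis X" and g: "g \<in> S \<inter> T" for S T g
  proof -
    obtain f1 K1 e1 f2 K2 e2 where
      1: "S = ck_basic X f1 K1 e1" "f1 \<in> cfuns X" "K1 \<in> compacts X" and
      2: "T = ck_basic X f2 K2 e2" "f2 \<in> cfuns X" "K2 \<in> compacts X"
      using S T by (auto simp: ck_basis_def)
    have gc: "g \<in> cfuns X" using g 1 by (auto simp: ck_basic_def)
    obtain d1 d2 where d: "d1 > 0" "ck_basic X g K1 d1 \<subseteq> S" "d2 > 0" "ck_basic X g K2 d2 \<subseteq> T"
      using ck_basic_refine g 1 2 by (metis IntD1 IntD2)
    have K: "K1 \<union> K2 \<in> compacts X"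
      using 1 2 by (auto simp: compacts_def compactin_Un)
    have "ck_basic X g (K1 \<union> K2) (min d1 d2) \<subseteq> S \<inter> T"
      using ck_basic_antimono[OF gc 1(3) K, of "min d1 d2" d1]
        ck_basic_antimono[OF gc 2(3) K, of "min d1 d2" d2] d by auto
    moreover have "ck_basic X g (K1 \<union> K2) (min d1 d2) \<in> ck_basis X"
      using gc K d unfolding ck_basis_def by (metis (mono_tags, lifting) CollectI min_less_iff_conj)
    moreover have "g \<in> ck_basic X g (K1 \<union> K2) (min d1 d2)"
      using gc K d by (intro ck_basic_self) auto
    ultimately show ?thesis by blast
  qed
  then show ?thesis
    unfolding istopology_base_eq by (simp add: arbitrary_union_of_alt) blast
qed

lemma openin_Ck: "openin (Ck X) = arbitrary union_of (\<lambda>B. B \<in> ck_basis X)"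
  unfolding Ck_def using istopology_Ck[of X] by (simp add: topology_inverse')

lemma topspace_Ck:
  assumes "topspace X \<noteq> {}"
  shows "topspace (Ck X) = cfuns X"
proof
  show "topspace (Ck X) \<subseteq> cfuns X"
    unfolding topspace_def openin_Ck
    by (force simp: union_of_def arbitrary_def ck_basis_def ck_basic_def)
  obtain x where "x \<in> topspace X" using assms by blast
  then have K: "{x} \<in> compacts X" by (simp add: compacts_def)
  have "openin (Ck X) (ck_basic X f {x} 1)" if "f \<in> cfuns X" for f
    unfolding openin_Ck using that K
    by (intro arbitrary_union_of_inc) (force simp: ck_basis_def)
  then show "cfuns X \<subseteq> topspace (Ck X)"
    using ck_basic_self[OF _ K, of _ 1] openin_subset by fastforce
qed

end

theory Submission
  imports Defs
begin

text \<open>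
  Both \<open>k\<close>-covers and the sets accumulating at a point \<open>z\<close> are collections that \<^emph>\<open>hit\<close> a directed
  system of requirements: every compact set has to be contained in some member of the cover, and
  every neighbourhood of \<open>z\<close> has to contain some element of the set. The systems are directed, and
  each single object (a proper open set, a function other than \<open>z\<close>) fails some requirement, so a
  hitting collection stays hitting when finitely many objects are removed. For such
  collections, groupability says that there are disjoint finite groups of objects such that every
  requirement is met in all but finitely many groups (\<open>groupable_hitting_eventually\<close>,
  \<open>point_finite_imp_groupable\<close>).

  If a subset of a countable hitting collection is groupable, so is the whole collection,
  because the remaining objects can be added to the groups one at a time. Hence
  \<open>S\<^sub>1(\<CC>, \<CC>\<^sup>g\<^sup>p)\<close> is equivalent to \<open>S\<^sub>1(\<CC>, \<CC>)\<close> together with the groupability of all countable members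
  of \<open>\<CC>\<close> (\<open>S1_gp_hitting_iff\<close>). Applied to the sets accumulating at \<open>z\<close>, this is exactly the
  conjunction of the Reznichenko property and countable strong fan-tightness at \<open>z\<close>.

  The passage between \<open>k\<close>-covers and function spaces goes through one transfer lemma
  (\<open>S1_gp_transfer\<close>) about two systems and a relation between their objects. In one direction a
  function \<open>g\<close> corresponds in inning \<open>n\<close> to the open sets on which \<open>g\<close> is within \<open>1/(n+1)\<close> of \<open>z\<close>; in
  the other, an open set \<open>U\<close> corresponds to the functions that are \<open>1\<close> off \<open>U\<close>. The first direction
  works at every \<open>z\<close>, as the Reznichenko property and countable strong fan-tightness demand.

  For the game, the selection principle first yields a Hurewicz-type statement
  (\<open>S1_gp_k_covers_imp_finite_selection\<close>): from a sequence of \<open>k\<close>-covers one can select finite subsets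
  such that each compact set is contained in a member of all but finitely many of them. Applied to
  the countable tree of positions of a strategy of One, it prunes this tree to a finitely branching
  one in which every compact set is caught at all but finitely many positions. At a level
  of the pruned tree, the sets contained in one answer from each of the finitely many positions can
  be used whatever branch is taken. Such sets, taken over any infinite set of levels, form a
  \<open>k\<close>-cover, so one application of \<open>S\<^sub>1\<close>, with disjoint sets of levels for different innings, produces
  a branch on which Two collects a \<open>k\<close>-cover; being countable, that cover is groupable.
\<close>

section \<open>Families that hit a directed system of requirements\<close>

definition hitting :: "'c set \<Rightarrow> 'p set \<Rightarrow> ('p \<Rightarrow> 'c \<Rightarrow> bool) \<Rightarrow> 'c set set" where
  "hitting T P R = {C. C \<subseteq> T \<and> (\<forall>p\<in>P. \<exists>c\<in>C. R p c)}"

lemma hittingI: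
  "C \<subseteq> T \<Longrightarrow> (\<And>p. p \<in> P \<Longrightarrow> \<exists>c\<in>C. R p c) \<Longrightarrow> C \<in> hitting T P R"
  by (simp add: hitting_def)

lemma hitting_subset: "C \<in> hitting T P R \<Longrightarrow> C \<subseteq> T"
  by (simp add: hitting_def)

lemma hittingD: "C \<in> hitting T P R \<Longrightarrow> p \<in> P \<Longrightarrow> \<exists>c\<in>C. R p c"
  by (simp add: hitting_def)

lemma groupable_countable:
  assumes "groupable \<CC> C"
  shows "countable C"
proof -
  obtain \<phi> :: "'a \<Rightarrow> nat" where "\<forall>n. finite {c \<in> C. \<phi> c = n}"
    using assms unfolding groupable_def by blast
  then have "countable (\<Union>n. {c \<in> C. \<phi> c = n})"
    by (auto intro: countable_finite)
  moreover have "C = (\<Union>n. {c \<in> C. \<phi> c = n})"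
    by auto
  ultimately show ?thesis
    by simp
qed

text \<open>Otherwise the groups that fail \<open>p\<close> form an infinite set \<open>J\<close>, and the union over \<open>J\<close> fails \<open>p\<close>.\<close>

lemma groupable_hitting_eventually:
  assumes J: "\<forall>J. infinite J \<longrightarrow> (\<Union>n\<in>J. {c \<in> C. \<phi> c = n}) \<in> hitting T P R"
    and p: "p \<in> P"
  shows "finite {m. \<not> (\<exists>c \<in> {c \<in> C. \<phi> c = m}. R p c)}"
proof (rule ccontr)
  let ?J = "{m. \<not> (\<exists>c \<in> {c \<in> C. \<phi> c = m}. R p c)}"
  assume "infinite ?J"
  then have "(\<Union>n\<in>?J. {c \<in> C. \<phi> c = n}) \<in> hitting T P R"
    using J by blast
  from hittingD[OF this p] show False
    by auto
qed

text \<open>Only finitely many \<open>H m\<close> meet \<open>H 0 \<union> \<dots> \<union> H M\<close>, so the next index can be chosen beyond all of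
  them.\<close>

lemma point_finite_disjoint_subsequence:
  fixes H :: "nat \<Rightarrow> 'c set"
  assumes fin: "\<And>m. finite (H m)" and pf: "\<And>c. finite {m. c \<in> H m}"
  obtains r :: "nat \<Rightarrow> nat" where "strict_mono r" "disjoint_family (\<lambda>i. H (r i))"
proof -
  have "\<exists>b>M. \<forall>m\<ge>b. \<forall>j\<le>M. H m \<inter> H j = {}" for M
  proof -
    have "finite (\<Union>j\<le>M. \<Union>c\<in>H j. {m. c \<in> H m})"
      using fin pf by simp
    then obtain b where b: "\<forall>m \<in> (\<Union>j\<le>M. \<Union>c\<in>H j. {m. c \<in> H m}). m < b"
      using finite_nat_set_iff_bounded by blast
    have "H m \<inter> H j = {}" if "m \<ge> max b (Suc M)" "j \<le> M" for m j
      using b that by fastforce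
    then show ?thesis
      by (intro exI[of _ "max b (Suc M)"]) auto
  qed
  then obtain b where b: "\<And>M. b M > M" "\<And>M m j. m \<ge> b M \<Longrightarrow> j \<le> M \<Longrightarrow> H m \<inter> H j = {}"
    by metis
  define r where "r i = (b ^^ i) 0" for i
  have rS: "r (Suc i) = b (r i)" for i
    by (simp add: r_def)
  have mono: "strict_mono r"
    by (simp add: strict_mono_Suc_iff rS b)
  have "H (r i) \<inter> H (r j) = {}" if "i < j" for i j
  proof -
    have "b (r i) \<le> r j"
      using that mono by (metis Suc_leI rS strict_mono_less_eq)
    then show ?thesis
      using b(2)[of "r i" "r j" "r i"] by auto
  qed
  then have "disjoint_family (\<lambda>i. H (r i))"
    unfolding disjoint_family_on_def by (metis inf_commute linorder_neqE_nat)
  with mono show thesis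
    by (rule that)
qed

text \<open>Disjointness of the groups can be relaxed to point-finiteness, which is what the selections
  made below satisfy: a disjoint subsequence still meets every requirement eventually. The objects
  outside this subsequence are spread over the groups by an enumeration of \<open>C\<close>. Overlaps
  without such a bound would say nothing: the initial segments of an enumeration of any countable
  hitting \<open>C\<close> meet every requirement eventually.\<close>

lemma point_finite_imp_groupable:
  fixes H :: "nat \<Rightarrow> 'c set"
  assumes C: "C \<subseteq> T" "countable C"
    and H: "\<And>m. finite (H m)" "\<And>m. H m \<subseteq> C" "\<And>c. finite {m. c \<in> H m}"
    and ev: "\<And>p. p \<in> P \<Longrightarrow> finite {m. \<not> (\<exists>c\<in>H m. R p c)}"
  shows "groupable (hitting T P R) C"
proof -
  obtain r :: "nat \<Rightarrow> nat" where r: "strict_mono r" "disjoint_family (\<lambda>i. H (r i))"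
    using point_finite_disjoint_subsequence[of H] H by metis
  have uniq: "i = j" if "c \<in> H (r i)" "c \<in> H (r j)" for c i j
    using r(2) that unfolding disjoint_family_on_def by blast
  define \<phi> where
    "\<phi> c = (if \<exists>i. c \<in> H (r i) then (THE i. c \<in> H (r i)) else to_nat_on C c)" for c
  have \<phi>: "\<phi> c = i" if "c \<in> H (r i)" for c i
    using that uniq unfolding \<phi>_def by (auto intro: the_equality)
  have "{c \<in> C. \<phi> c = n} \<subseteq> H (r n) \<union> (to_nat_on C -` {n} \<inter> C)" for n
  proof
    fix c assume c: "c \<in> {c \<in> C. \<phi> c = n}"
    show "c \<in> H (r n) \<union> (to_nat_on C -` {n} \<inter> C)"
    proof (cases "\<exists>i. c \<in> H (r i)")
      case True
      then show ?thesis
        using c \<phi> by blast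
    next
      case False
      then have "\<phi> c = to_nat_on C c"
        by (simp add: \<phi>_def)
      with c show ?thesis
        by simp
    qed
  qed
  moreover have "finite (to_nat_on C -` {n} \<inter> C)" for n
    by (intro finite_vimage_IntI inj_on_to_nat_on C) simp
  ultimately have fib: "finite {c \<in> C. \<phi> c = n}" for n
    using H(1) by (meson finite_UnI finite_subset)
  have "(\<Union>n\<in>J. {c \<in> C. \<phi> c = n}) \<in> hitting T P R" if J: "infinite J" for J
  proof (rule hittingI)
    show "(\<Union>n\<in>J. {c \<in> C. \<phi> c = n}) \<subseteq> T"
      using C by auto
    fix p assume "p \<in> P"
    then have "finite (r -` {m. \<not> (\<exists>c\<in>H m. R p c)})"
      using ev r(1) by (intro finite_vimageI strict_mono_imp_inj_on)
    then obtain n where "n \<in> J" "n \<notin> r -` {m. \<not> (\<exists>c\<in>H m. R p c)}"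
      using J by (meson finite_subset subsetI)
    then obtain c where "c \<in> H (r n)" "R p c"
      by auto
    with \<open>n \<in> J\<close> show "\<exists>c \<in> (\<Union>n\<in>J. {c \<in> C. \<phi> c = n}). R p c"
      using H(2) \<phi> by blast
  qed
  with fib show ?thesis
    unfolding groupable_def by blast
qed

lemma groupable_hitting_mono:
  assumes B: "groupable (hitting T P R) B" and "B \<subseteq> C" "C \<subseteq> T" "countable C"
  shows "groupable (hitting T P R) C"
proof -
  obtain \<phi> :: "'a \<Rightarrow> nat" where \<phi>: "\<forall>n. finite {c \<in> B. \<phi> c = n}"
      "\<forall>J. infinite J \<longrightarrow> (\<Union>n\<in>J. {c \<in> B. \<phi> c = n}) \<in> hitting T P R"
    using B unfolding groupable_def by blast
  show ?thesis
  proof (rule point_finite_imp_groupable[where H = "\<lambda>m. {c \<in> B. \<phi> c = m}"])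
    show "finite {m. c \<in> {c \<in> B. \<phi> c = m}}" for c
      by (rule finite_subset[of _ "{\<phi> c}"]) auto
  qed (use assms \<phi> groupable_hitting_eventually[OF \<phi>(2)] in auto)
qed

text \<open>For the groupability of a countable \<open>C\<close>, the selection principle is applied to the constant
  sequence \<open>C\<close>: it gives a groupable subset of \<open>C\<close>, from which groupability extends to \<open>C\<close>.\<close>

lemma S1_gp_hitting_iff:
  fixes T :: "'c set" and P :: "'p set" and R :: "'p \<Rightarrow> 'c \<Rightarrow> bool"
  defines "\<CC> \<equiv> hitting T P R"
  shows "S1 \<CC> (gp \<CC>) \<longleftrightarrow> S1 \<CC> \<CC> \<and> (\<forall>C\<in>\<CC>. countable C \<longrightarrow> groupable \<CC> C)"
proof (intro iffI conjI ballI impI)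
  assume S: "S1 \<CC> (gp \<CC>)"
  then show "S1 \<CC> \<CC>"
    unfolding S1_def gp_def by blast
  fix C assume C: "C \<in> \<CC>" "countable C"
  obtain a where "\<forall>n::nat. a n \<in> C" "range a \<in> gp \<CC>"
    using S[unfolded S1_def, rule_format, of "\<lambda>_. C"] C(1) by blast
  then show "groupable \<CC> C"
    using C groupable_hitting_mono[of T P R "range a" C] hitting_subset[of C T P R]
    unfolding gp_def \<CC>_def by blast
next
  assume "S1 \<CC> \<CC> \<and> (\<forall>C\<in>\<CC>. countable C \<longrightarrow> groupable \<CC> C)"
  then show "S1 \<CC> (gp \<CC>)"
    unfolding S1_def gp_def by (metis (mono_tags, lifting) CollectI countableI_type countable_image)
qed

locale requirement_system =
  fixes T :: "'c set" and P :: "'p set" and R :: "'p \<Rightarrow> 'c \<Rightarrow> bool"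
  assumes P_nonempty: "P \<noteq> {}"
    and directed: "p \<in> P \<Longrightarrow> q \<in> P \<Longrightarrow> \<exists>s\<in>P. \<forall>c\<in>T. R s c \<longrightarrow> R p c \<and> R q c"
    and missed: "c \<in> T \<Longrightarrow> \<exists>p\<in>P. \<not> R p c"
begin

text \<open>By directedness, \<open>p\<close> can be combined with one requirement missed by each element of \<open>E\<close>.\<close>

lemma strengthen_to_miss_finite:
  assumes "finite E" "E \<subseteq> T" "p \<in> P"
  shows "\<exists>q\<in>P. (\<forall>c\<in>T. R q c \<longrightarrow> R p c) \<and> (\<forall>c\<in>E. \<not> R q c)"
  using assms
proof (induction E)
  case empty
  then show ?case by blast
next
  case (insert e E)
  then obtain q where q: "q \<in> P" "\<forall>c\<in>T. R q c \<longrightarrow> R p c" "\<forall>c\<in>E. \<not> R q c"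
    by auto
  obtain q' where q': "q' \<in> P" "\<not> R q' e"
    using insert missed by blast
  obtain s where "s \<in> P" "\<forall>c\<in>T. R s c \<longrightarrow> R q c \<and> R q' c"
    using directed q(1) q'(1) by meson
  with q q' insert.prems show ?case
    by (intro bexI[of _ s]) auto
qed

lemma hitting_Diff_finite:
  assumes "C \<in> hitting T P R" "finite E"
  shows "C - E \<in> hitting T P R"
proof (rule hittingI)
  show "C - E \<subseteq> T"
    using hitting_subset[OF assms(1)] by blast
  fix p assume "p \<in> P"
  then obtain q where q: "q \<in> P" "\<forall>c\<in>T. R q c \<longrightarrow> R p c" "\<forall>c \<in> E \<inter> T. \<not> R q c"
    using strengthen_to_miss_finite[of "E \<inter> T" p] assms(2) by auto
  obtain c where "c \<in> C" "R q c"
    using hittingD[OF assms(1) q(1)] by blast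
  then show "\<exists>c \<in> C - E. R p c"
    using q hitting_subset[OF assms(1)] by blast
qed

lemma hitting_infinite:
  assumes "C \<in> hitting T P R"
  shows "infinite C"
proof
  assume "finite C"
  then have "{} \<in> hitting T P R"
    using hitting_Diff_finite[OF assms, of C] by simp
  with P_nonempty show False
    by (auto simp: hitting_def)
qed

lemma hitting_range_late:
  assumes "range a \<in> hitting T P R" "p \<in> P"
  shows "\<exists>n\<ge>N::nat. R p (a n)"
proof -
  have "range a - a ` {..<N} \<in> hitting T P R"
    using assms(1) by (rule hitting_Diff_finite) simp
  from hittingD[OF this assms(2)] obtain n where "a n \<notin> a ` {..<N}" "R p (a n)"
    by blast
  then show ?thesis
    by (metis image_eqI lessThan_iff not_le)
qed

end

text \<open>Read \<open>D n d c\<close> as ``in inning \<open>n\<close>, selecting \<open>d\<close> justifies selecting \<open>c\<close>''. Selections in the primed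
  system are pulled back along \<open>D\<close>, and \<open>reflect\<close> turns requirements met by late primed selections
  into requirements met by the pulled-back ones. Groups are pulled back as well; they need not
  remain disjoint, because different primed objects may justify the same \<open>c\<close>. Offering in inning \<open>n\<close>
  only the elements of \<open>C\<close> enumerated after the \<open>n\<close>-th makes the pulled-back groups point-finite.\<close>

lemma S1_gp_transfer:
  fixes T :: "'c set" and T' :: "'d set" and D :: "nat \<Rightarrow> 'd \<Rightarrow> 'c \<Rightarrow> bool"
  assumes sys: "requirement_system T P R" and sys': "requirement_system T' P' R'"
    and image: "\<And>n C. C \<in> hitting T P R \<Longrightarrow> {d \<in> T'. \<exists>c\<in>C. D n d c} \<in> hitting T' P' R'"
    and reflect: "\<And>p. p \<in> P \<Longrightarrow> \<exists>p'\<in>P'. \<exists>N. \<forall>n\<ge>N. \<forall>d\<in>T'. \<forall>c\<in>T. D n d c \<longrightarrow> R' p' d \<longrightarrow> R p c"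
    and S': "S1 (hitting T' P' R') (gp (hitting T' P' R'))"
  shows "S1 (hitting T P R) (gp (hitting T P R))"
proof -
  interpret S: requirement_system T P R by fact
  interpret S': requirement_system T' P' R' by fact
  have select: "\<exists>d c. range d \<in> gp (hitting T' P' R') \<and> (\<forall>n. c n \<in> \<C> n \<and> D n (d n) (c n))"
    if "\<And>n. \<C> n \<in> hitting T P R" for \<C>
  proof -
    have "\<forall>n. {d \<in> T'. \<exists>c\<in>\<C> n. D n d c} \<in> hitting T' P' R'"
      using image that by blast
    with S' obtain d where "\<forall>n. d n \<in> {d \<in> T'. \<exists>c\<in>\<C> n. D n d c}" "range d \<in> gp (hitting T' P' R')"
      unfolding S1_def by meson
    then show ?thesis
      by (intro exI[of _ d]) (simp, metis)
  qed
  have "S1 (hitting T P R) (hitting T P R)"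
    unfolding S1_def
  proof (intro allI impI)
    fix \<C> :: "nat \<Rightarrow> 'c set" assume \<C>: "\<forall>n. \<C> n \<in> hitting T P R"
    then obtain d c where d: "range d \<in> hitting T' P' R'" and c: "\<And>n. c n \<in> \<C> n" "\<And>n. D n (d n) (c n)"
      using select[of \<C>] by (auto simp: gp_def)
    have cT: "c n \<in> T" for n
      using \<C> c(1) hitting_subset by blast
    have dT: "d n \<in> T'" for n
      using d hitting_subset by blast
    have "range c \<in> hitting T P R"
    proof (rule hittingI)
      show "range c \<subseteq> T"
        using cT by blast
      fix p assume "p \<in> P"
      then obtain p' N where p': "p' \<in> P'"
        and N: "\<forall>n\<ge>N. \<forall>d\<in>T'. \<forall>c\<in>T. D n d c \<longrightarrow> R' p' d \<longrightarrow> R p c"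
        using reflect by meson
      obtain n where "n \<ge> N" "R' p' (d n)"
        using S'.hitting_range_late[OF d p'] by blast
      then show "\<exists>c\<in>range c. R p c"
        using N c(2) cT dT by blast
    qed
    with c(1) show "\<exists>a. (\<forall>n. a n \<in> \<C> n) \<and> range a \<in> hitting T P R"
      by blast
  qed
  moreover have "groupable (hitting T P R) C" if C: "C \<in> hitting T P R" "countable C" for C
  proof -
    define u where "u = from_nat_into C"
    have u: "bij_betw u UNIV C"
      unfolding u_def using C S.hitting_infinite bij_betw_from_nat_into by blast
    \<comment> \<open>Innings later than the index of an element cannot select it any more.\<close>
    define \<C> where "\<C> n = C - u ` {..n}" for n
    have "\<C> n \<in> hitting T P R" for n
      unfolding \<C>_def using C(1) by (rule S.hitting_Diff_finite) simp
    then obtain d c where d: "range d \<in> gp (hitting T' P' R')"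
      and c: "\<And>n. c n \<in> \<C> n" "\<And>n. D n (d n) (c n)"
      using select[of \<C>] by blast
    have cT: "c n \<in> T" for n
      using c(1) C(1) hitting_subset unfolding \<C>_def by blast
    have dT: "d n \<in> T'" for n
      using d hitting_subset unfolding gp_def by blast
    obtain \<phi> :: "'d \<Rightarrow> nat" where fin: "\<And>n. finite {x \<in> range d. \<phi> x = n}"
      and J: "\<forall>J. infinite J \<longrightarrow> (\<Union>n\<in>J. {x \<in> range d. \<phi> x = n}) \<in> hitting T' P' R'"
      using d unfolding gp_def groupable_def by blast
    \<comment> \<open>A value of \<open>d\<close> may recur; \<open>inv d\<close> picks one inning for each value.\<close>
    define H where "H m = (\<lambda>x. c (inv d x)) ` {x \<in> range d. \<phi> x = m}" for m
    have late: "n < k" if "c n = u k" for n k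
      using that c(1)[of n] unfolding \<C>_def by (metis DiffD2 atMost_iff image_eqI not_le)
    show ?thesis
    proof (rule point_finite_imp_groupable[where H = H])
      show "C \<subseteq> T"
        using C(1) by (rule hitting_subset)
      show "countable C" by fact
      show "finite (H m)" for m
        unfolding H_def using fin by simp
      show HC: "H m \<subseteq> C" for m
        unfolding H_def using c(1) by (auto simp: \<C>_def)
      show "finite {m. x \<in> H m}" for x
      proof (cases "x \<in> C")
        case True
        then obtain k where k: "x = u k"
          using u by (auto simp: bij_betw_def)
        have "{m. x \<in> H m} \<subseteq> (\<lambda>n. \<phi> (d n)) ` {..<k}"
        proof
          fix m assume "m \<in> {m. x \<in> H m}"
          then obtain y where y: "y \<in> range d" "\<phi> y = m" "x = c (inv d y)"
            unfolding H_def by auto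
          have "d (inv d y) = y"
            using y(1) by (rule f_inv_into_f)
          then show "m \<in> (\<lambda>n. \<phi> (d n)) ` {..<k}"
            using late[of "inv d y" k] y k by (intro image_eqI[of _ _ "inv d y"]) auto
        qed
        then show ?thesis
          by (rule finite_subset) simp
      next
        case False
        with HC have "{m. x \<in> H m} = {}"
          by blast
        then show ?thesis
          by simp
      qed
      fix p assume "p \<in> P"
      then obtain p' N where p': "p' \<in> P'"
        and N: "\<forall>n\<ge>N. \<forall>d\<in>T'. \<forall>c\<in>T. D n d c \<longrightarrow> R' p' d \<longrightarrow> R p c"
        using reflect by meson
      let ?bad = "{m. \<not> (\<exists>x \<in> {x \<in> range d. \<phi> x = m}. R' p' x)}"
      have "{m. \<not> (\<exists>c\<in>H m. R p c)} \<subseteq> ?bad \<union> (\<lambda>n. \<phi> (d n)) ` {..<N}"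
      proof (rule subsetI, rule ccontr)
        fix m assume "m \<in> {m. \<not> (\<exists>c\<in>H m. R p c)}"
        then have m: "\<not> (\<exists>c\<in>H m. R p c)" by simp
        assume not: "m \<notin> ?bad \<union> (\<lambda>n. \<phi> (d n)) ` {..<N}"
        then obtain y where y: "y \<in> range d" "\<phi> y = m" "R' p' y"
          by blast
        have dy: "d (inv d y) = y"
          using y(1) by (rule f_inv_into_f)
        have "N \<le> inv d y"
        proof (rule ccontr)
          assume "\<not> N \<le> inv d y"
          then have "m \<in> (\<lambda>n. \<phi> (d n)) ` {..<N}"
            using y(2) dy by (intro image_eqI[of _ _ "inv d y"]) auto
          with not show False by blast
        qed
        moreover have "R' p' (d (inv d y))"
          using y(3) dy by simp
        ultimately have "R p (c (inv d y))"
          using N c(2)[of "inv d y"] cT dT by blast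
        with m y show False
          unfolding H_def by blast
      qed
      then show "finite {m. \<not> (\<exists>c\<in>H m. R p c)}"
        by (rule finite_subset) (use groupable_hitting_eventually[OF J p'] in simp)
    qed
  qed
  ultimately show ?thesis
    using S1_gp_hitting_iff by blast
qed

section \<open>Covers and accumulating sets as hitting families\<close>

lemma proper_opens_subset: "U \<in> proper_opens X \<Longrightarrow> U \<subset> topspace X"
  using openin_subset[of X U] by (auto simp: proper_opens_def)

lemma k_covers_hitting:
  "k_covers X = hitting (proper_opens X) (compacts X) (\<lambda>K U. K \<subseteq> U)"
proof -
  have "\<Union>\<U> = topspace X"
    if "\<U> \<subseteq> proper_opens X" and "\<forall>K \<in> compacts X. \<exists>U \<in> \<U>. K \<subseteq> U" for \<U>
  proof (intro equalityI subsetI)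
    show "x \<in> topspace X" if "x \<in> \<Union>\<U>" for x
      using that \<open>\<U> \<subseteq> proper_opens X\<close> proper_opens_subset by fast
    show "x \<in> \<Union>\<U>" if "x \<in> topspace X" for x
      using that \<open>\<forall>K \<in> compacts X. \<exists>U \<in> \<U>. K \<subseteq> U\<close>[rule_format, of "{x}"]
      by (auto simp: compacts_def)
  qed
  then have "\<U> \<in> k_covers X \<longleftrightarrow> \<U> \<in> hitting (proper_opens X) (compacts X) (\<lambda>K U. K \<subseteq> U)" for \<U>
    unfolding k_covers_def hitting_def mem_Collect_eq by metis
  then show ?thesis
    by (rule set_eqI)
qed

lemma compacts_Un: "K \<in> compacts X \<Longrightarrow> L \<in> compacts X \<Longrightarrow> K \<union> L \<in> compacts X"
  by (auto simp: compacts_def compactin_Un)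

lemma compacts_sing: "x \<in> topspace X \<Longrightarrow> {x} \<in> compacts X"
  by (simp add: compacts_def)

lemma compacts_subset: "K \<in> compacts X \<Longrightarrow> K \<subseteq> topspace X"
  by (simp add: compacts_def compactin_subset_topspace)

lemma requirement_system_k_covers:
  assumes "topspace X \<noteq> {}"
  shows "requirement_system (proper_opens X) (compacts X) (\<lambda>K U. K \<subseteq> U)"
proof
  show "compacts X \<noteq> {}"
    using assms compacts_sing[of _ X] by fast
  show "\<exists>M\<in>compacts X. \<forall>U\<in>proper_opens X. M \<subseteq> U \<longrightarrow> K \<subseteq> U \<and> L \<subseteq> U"
    if "K \<in> compacts X" "L \<in> compacts X" for K L
    using compacts_Un[OF that] by (intro bexI[of _ "K \<union> L"]) auto
  show "\<exists>K\<in>compacts X. \<not> K \<subseteq> U" if "U \<in> proper_opens X" for U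
  proof -
    obtain x where "x \<in> topspace X" "x \<notin> U"
      using proper_opens_subset[OF \<open>U \<in> proper_opens X\<close>] by blast
    then show ?thesis
      using compacts_sing by (intro bexI[of _ "{x}"]) auto
  qed
qed

text \<open>Uniform closeness to \<open>z\<close>, stated pointwise so that no supremum has to be handled.\<close>

definition close_on :: "('a \<Rightarrow> real) \<Rightarrow> 'a set \<times> real \<Rightarrow> ('a \<Rightarrow> real) \<Rightarrow> bool" where
  "close_on z = (\<lambda>(K, \<epsilon>) g. \<forall>x\<in>K. \<bar>z x - g x\<bar> < \<epsilon>)"

lemma close_on_simp [simp]: "close_on z (K, \<epsilon>) g \<longleftrightarrow> (\<forall>x\<in>K. \<bar>z x - g x\<bar> < \<epsilon>)"
  by (simp add: close_on_def)

lemma Omega_Ck_hitting: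
  assumes X: "topspace X \<noteq> {}" and z: "z \<in> cfuns X"
  shows "Omega (Ck X) z = hitting (cfuns X - {z}) (compacts X \<times> {0<..}) (close_on z)"
proof -
  have basic_open: "openin (Ck X) (ck_basic X z K \<epsilon>)" if "K \<in> compacts X" "\<epsilon> > 0" for K \<epsilon>
    unfolding openin_Ck using that z
    by (intro arbitrary_union_of_inc) (force simp: ck_basis_def)
  have iff: "z \<in> Ck X closure_of A \<longleftrightarrow> (\<forall>p \<in> compacts X \<times> {0<..}. \<exists>g\<in>A. close_on z p g)"
    if A: "A \<subseteq> cfuns X" for A
  proof
    assume cl: "z \<in> Ck X closure_of A"
    show "\<forall>p \<in> compacts X \<times> {0<..}. \<exists>g\<in>A. close_on z p g"
    proof
      fix p :: "'a set \<times> real" assume "p \<in> compacts X \<times> {0<..}"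
      then obtain K \<epsilon> where p: "p = (K, \<epsilon>)" and K: "K \<in> compacts X" and \<epsilon>: "\<epsilon> > 0"
        by auto
      obtain g where g: "g \<in> A" "g \<in> ck_basic X z K \<epsilon>"
        using cl basic_open[OF K \<epsilon>] ck_basic_self[OF z K \<epsilon>] by (auto simp: in_closure_of)
      have "\<bar>z x - g x\<bar> < \<epsilon>" if "x \<in> K" for x
      proof -
        have "\<bar>z x - g x\<bar> \<le> (SUP x\<in>K. \<bar>z x - g x\<bar>)"
          using that A g(1) by (intro cSUP_upper bdd_above_cfuns_diff[OF z _ K]) auto
        also have "\<dots> < \<epsilon>"
          using g(2) by (simp add: ck_basic_def)
        finally show ?thesis .
      qed
      with g(1) show "\<exists>g\<in>A. close_on z p g"
        by (auto simp: p)
    qed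
  next
    assume hit: "\<forall>p \<in> compacts X \<times> {0<..}. \<exists>g\<in>A. close_on z p g"
    have "\<exists>g\<in>A. g \<in> V" if "z \<in> V" "openin (Ck X) V" for V
    proof -
      obtain B where B: "B \<in> ck_basis X" "z \<in> B" "B \<subseteq> V"
      proof -
        have "\<forall>f\<in>V. \<exists>B. B \<in> ck_basis X \<and> f \<in> B \<and> B \<subseteq> V"
          using \<open>openin (Ck X) V\<close> unfolding openin_Ck by (subst (asm) arbitrary_union_of_alt)
        then show thesis
          using that \<open>z \<in> V\<close> by blast
      qed
      obtain f K \<epsilon> where "B = ck_basic X f K \<epsilon>" "f \<in> cfuns X" and K: "K \<in> compacts X"
        using B(1) unfolding ck_basis_def by blast
      then obtain \<delta> where \<delta>: "\<delta> > 0" "ck_basic X z K \<delta> \<subseteq> V"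
        using ck_basic_refine B(2,3) by (metis order_trans)
      obtain g where g: "g \<in> A" "close_on z (K, \<delta> / 2) g"
        using hit K \<delta>(1) by (metis SigmaI greaterThan_iff half_gt_zero)
      have "(SUP x\<in>K. \<bar>z x - g x\<bar>) \<le> \<delta> / 2"
        using K g(2) by (intro cSUP_least) (auto simp: compacts_def less_imp_le)
      then have "g \<in> ck_basic X z K \<delta>"
        using g(1) A \<delta>(1) by (auto simp: ck_basic_def)
      with g(1) \<delta>(2) show ?thesis by blast
    qed
    then show "z \<in> Ck X closure_of A"
      using z by (auto simp: in_closure_of topspace_Ck[OF X])
  qed
  show ?thesis
  proof (rule set_eqI)
    fix A
    show "A \<in> Omega (Ck X) z \<longleftrightarrow> A \<in> hitting (cfuns X - {z}) (compacts X \<times> {0<..}) (close_on z)"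
      unfolding Omega_def hitting_def topspace_Ck[OF X] mem_Collect_eq Diff_iff
      using iff[of A] by (metis Diff_empty subset_Diff_insert)
  qed
qed

lemma requirement_system_Omega:
  assumes X: "topspace X \<noteq> {}" and z: "z \<in> cfuns X"
  shows "requirement_system (cfuns X - {z}) (compacts X \<times> {0<..}) (close_on z)"
proof
  show "compacts X \<times> {0::real<..} \<noteq> {}"
    using assms compacts_sing by (metis Sigma_empty_iff ex_in_conv greaterThan_iff zero_less_one)
  show "\<exists>s\<in>compacts X \<times> {0<..}. \<forall>g\<in>cfuns X - {z}. close_on z s g \<longrightarrow> close_on z p g \<and> close_on z q g"
    if "p \<in> compacts X \<times> {0<..}" "q \<in> compacts X \<times> {0<..}" for p q
    using that compacts_Un
    by (intro bexI[of _ "(fst p \<union> fst q, min (snd p) (snd q))"]) (auto simp: close_on_def)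
  show "\<exists>p\<in>compacts X \<times> {0<..}. \<not> close_on z p g" if g: "g \<in> cfuns X - {z}" for g
  proof -
    obtain x where x: "x \<in> topspace X" "z x \<noteq> g x"
      using z g extensionalityI[of z "topspace X" g] by (auto simp: cfuns_def)
    then show ?thesis
      using compacts_sing by (intro bexI[of _ "({x}, \<bar>z x - g x\<bar>)"]) auto
  qed
qed

section \<open>Duality between open sets and continuous functions\<close>

text \<open>A function \<open>g\<close> is paired with every proper open \<open>U\<close> on which it is close to \<open>z\<close>, not only with the
  largest one. This matters when \<open>g\<close> is close to \<open>z\<close> on all of \<open>X\<close>: then \<open>U\<close> can be the complement of a
  point outside the given compact set, and such a point exists as \<open>X\<close> is not compact.\<close>

lemma S1_gp_k_covers_imp_Omega:
  assumes t1: "t1_space X" and nc: "\<not> compact_space X" and z: "z \<in> cfuns X"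
    and S: "S1 (k_covers X) (gp (k_covers X))"
  shows "S1 (Omega (Ck X) z) (gp (Omega (Ck X) z))"
proof -
  have ne: "topspace X \<noteq> {}"
    using nc compactin_empty[of X] unfolding compact_space_def by metis
  define D where "D n U g \<longleftrightarrow> (\<forall>x\<in>U. \<bar>z x - g x\<bar> < inverse (real (Suc n)))" for n U and g :: "'a \<Rightarrow> real"
  have image: "{U \<in> proper_opens X. \<exists>g\<in>A. D n U g} \<in> hitting (proper_opens X) (compacts X) (\<lambda>K U. K \<subseteq> U)"
    if A: "A \<in> hitting (cfuns X - {z}) (compacts X \<times> {0<..}) (close_on z)" for n A
  proof (rule hittingI)
    fix K assume K: "K \<in> compacts X"
    then obtain g where g: "g \<in> A" "close_on z (K, inverse (real (Suc n))) g"
      using hittingD[OF A, of "(K, inverse (real (Suc n)))"] by auto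
    have gc: "g \<in> cfuns X"
      using hitting_subset[OF A] g(1) by blast
    obtain y where y: "y \<in> topspace X" "y \<notin> K"
    proof -
      have "K \<noteq> topspace X"
        using K nc by (auto simp: compacts_def compact_space_def)
      then show thesis
        using that compacts_subset[OF K] by blast
    qed
    define V where "V = {x \<in> topspace X. \<bar>z x - g x\<bar> \<in> {..<inverse (real (Suc n))}}"
    have "continuous_map X euclideanreal (\<lambda>x. \<bar>z x - g x\<bar>)"
      using z gc by (intro continuous_intros) (auto simp: cfuns_def)
    then have "openin X V"
      unfolding V_def by (rule openin_continuous_map_preimage) simp
    then have "openin X (V - {y})"
      using t1 unfolding t1_space_openin_delete_alt by simp
    moreover have KV: "K \<subseteq> V - {y}"
      using g(2) y(2) compacts_subset[OF K] unfolding V_def by auto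
    moreover have "K \<noteq> {}"
      using K by (simp add: compacts_def)
    ultimately have "V - {y} \<in> proper_opens X"
      using y(1) unfolding proper_opens_def by blast
    moreover have "D n (V - {y}) g"
      by (auto simp: D_def V_def)
    ultimately show "\<exists>U\<in>{U \<in> proper_opens X. \<exists>g\<in>A. D n U g}. K \<subseteq> U"
      using g(1) KV by blast
  qed auto
  have reflect: "\<exists>K\<in>compacts X. \<exists>N. \<forall>n\<ge>N. \<forall>U\<in>proper_opens X. \<forall>g\<in>cfuns X - {z}.
      D n U g \<longrightarrow> K \<subseteq> U \<longrightarrow> close_on z p g"
    if pP: "p \<in> compacts X \<times> {0<..}" for p
  proof -
    obtain K \<epsilon> where p: "p = (K, \<epsilon>)" and K: "K \<in> compacts X" and "\<epsilon> > 0"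
      using pP by auto
    then obtain N where N: "inverse (real (Suc N)) < \<epsilon>"
      using reals_Archimedean by blast
    have "inverse (real (Suc n)) < \<epsilon>" if "n \<ge> N" for n
      using N that by (smt (verit) Suc_le_mono inverse_positive_iff_positive le_imp_inverse_le of_nat_0_less_iff of_nat_mono zero_less_Suc)
    then have "\<forall>n\<ge>N. \<forall>U g. D n U g \<longrightarrow> K \<subseteq> U \<longrightarrow> close_on z p g"
      unfolding D_def p by fastforce
    with K show ?thesis by blast
  qed
  show ?thesis
    unfolding Omega_Ck_hitting[OF ne z]
    by (rule S1_gp_transfer[OF requirement_system_Omega[OF ne z] requirement_system_k_covers[OF ne] image reflect])
       (use S in \<open>simp_all add: k_covers_hitting\<close>)
qed

lemma zero_fun_cfuns: "zero_fun X \<in> cfuns X"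
proof -
  have "continuous_map X euclideanreal (\<lambda>x. 0)"
    by simp
  then show ?thesis
    unfolding cfuns_def zero_fun_def by (auto intro: continuous_map_eq)
qed

text \<open>If \<open>g\<close> is \<open>1\<close> off \<open>U\<close> and \<open>\<bar>g\<bar> < 1\<close> on \<open>K\<close>, then \<open>K \<subseteq> U\<close>; complete regularity supplies enough such
  functions that are \<open>0\<close> on \<open>K\<close>.\<close>

lemma S1_gp_Omega_imp_k_covers:
  assumes cr: "completely_regular_space X" and ne: "topspace X \<noteq> {}"
    and S: "S1 (Omega (Ck X) (zero_fun X)) (gp (Omega (Ck X) (zero_fun X)))"
  shows "S1 (k_covers X) (gp (k_covers X))"
proof -
  define D where "D n g U \<longleftrightarrow> (\<forall>x \<in> topspace X - U. g x = 1)" for n :: nat and g :: "'a \<Rightarrow> real" and U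
  let ?z = "zero_fun X"
  have image: "{g \<in> cfuns X - {?z}. \<exists>U\<in>\<U>. D n g U}
      \<in> hitting (cfuns X - {?z}) (compacts X \<times> {0<..}) (close_on ?z)"
    if \<U>: "\<U> \<in> hitting (proper_opens X) (compacts X) (\<lambda>K U. K \<subseteq> U)" for n \<U>
  proof (rule hittingI)
    fix p :: "'a set \<times> real" assume "p \<in> compacts X \<times> {0<..}"
    then obtain K \<epsilon> where p: "p = (K, \<epsilon>)" and K: "K \<in> compacts X" and \<epsilon>: "\<epsilon> > 0"
      by auto
    obtain U where U: "U \<in> \<U>" "K \<subseteq> U"
      using hittingD[OF \<U> K] by blast
    have UX: "openin X U" "U \<noteq> topspace X"
      using U(1) hitting_subset[OF \<U>] by (auto simp: proper_opens_def)
    have "closedin X (topspace X - U)" "disjnt K (topspace X - U)" "compactin X K"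
      using UX K U(2) by (auto simp: compacts_def disjnt_def)
    then obtain f where f: "continuous_map X euclideanreal f" "f ` K \<subseteq> {0}" "f ` (topspace X - U) \<subseteq> {1}"
      using Urysohn_completely_regular_compact_closed_alt[OF cr] by metis
    define g where "g = restrict f (topspace X)"
    have "continuous_map X euclideanreal g"
      using f(1) by (rule continuous_map_eq) (simp add: g_def)
    then have "g \<in> cfuns X"
      by (simp add: cfuns_def g_def)
    moreover obtain y where y: "y \<in> topspace X" "y \<notin> U"
      using UX openin_subset[OF UX(1)] by blast
    moreover have D: "D n g U"
      using f(3) by (auto simp: D_def g_def)
    ultimately have "g \<in> cfuns X - {?z}"
      by (auto simp: D_def zero_fun_def)
    moreover have "close_on ?z p g"
      using f(2) \<epsilon> compacts_subset[OF K] by (auto simp: p g_def zero_fun_def)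
    ultimately show "\<exists>g\<in>{g \<in> cfuns X - {?z}. \<exists>U\<in>\<U>. D n g U}. close_on ?z p g"
      using D U(1) by blast
  qed auto
  have reflect: "\<exists>p\<in>compacts X \<times> {0<..}. \<exists>N. \<forall>n\<ge>N. \<forall>g\<in>cfuns X - {?z}. \<forall>U\<in>proper_opens X.
      D n g U \<longrightarrow> close_on ?z p g \<longrightarrow> K \<subseteq> U"
    if K: "K \<in> compacts X" for K
  proof (intro bexI exI allI ballI impI)
    show "(K, 1::real) \<in> compacts X \<times> {0<..}"
      using K by simp
    fix n :: nat and g U assume "D n g U" "close_on ?z (K, 1) g"
    moreover have "?z x = 0" if "x \<in> K" for x
      using compacts_subset[OF K] that by (auto simp: zero_fun_def)
    ultimately have "\<bar>g x\<bar> < 1" "x \<notin> U \<Longrightarrow> g x = 1" if "x \<in> K" for x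
      using compacts_subset[OF K] that by (force simp: D_def)+
    then show "K \<subseteq> U"
      by fastforce
  qed
  show ?thesis
    unfolding k_covers_hitting
    by (rule S1_gp_transfer[OF requirement_system_k_covers[OF ne] requirement_system_Omega[OF ne zero_fun_cfuns] image reflect])
       (use S in \<open>simp_all add: Omega_Ck_hitting[OF ne zero_fun_cfuns]\<close>)
qed

lemma S1_gp_Omega_iff_Reznichenko:
  assumes X: "topspace X \<noteq> {}"
  shows "(\<forall>z\<in>cfuns X. S1 (Omega (Ck X) z) (gp (Omega (Ck X) z)))
    \<longleftrightarrow> Reznichenko (Ck X) \<and> countable_strong_fan_tightness (Ck X)"
proof -
  have "Omega (Ck X) z \<inter> {A. A \<subseteq> topspace (Ck X) \<and> countable A \<and> infinite A} = gp (Omega (Ck X) z)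
      \<longleftrightarrow> (\<forall>A\<in>Omega (Ck X) z. countable A \<longrightarrow> groupable (Omega (Ck X) z) A)"
    if z: "z \<in> cfuns X" for z
  proof -
    have "A \<subseteq> topspace (Ck X) \<and> infinite A" if "A \<in> Omega (Ck X) z" for A
      using that requirement_system.hitting_infinite[OF requirement_system_Omega[OF X z]]
      unfolding Omega_Ck_hitting[OF X z, symmetric] by (auto simp: Omega_def)
    then show ?thesis
      unfolding gp_def using groupable_countable by blast
  qed
  moreover have "S1 (Omega (Ck X) z) (gp (Omega (Ck X) z)) \<longleftrightarrow> S1 (Omega (Ck X) z) (Omega (Ck X) z)
      \<and> (\<forall>A\<in>Omega (Ck X) z. countable A \<longrightarrow> groupable (Omega (Ck X) z) A)"
    if z: "z \<in> cfuns X" for z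
    unfolding Omega_Ck_hitting[OF X z] by (rule S1_gp_hitting_iff)
  ultimately show ?thesis
    unfolding Reznichenko_def countable_strong_fan_tightness_def topspace_Ck[OF X] by auto
qed

section \<open>The game\<close>

lemma k_coversI:
  assumes "\<U> \<subseteq> proper_opens X" "\<And>K. K \<in> compacts X \<Longrightarrow> \<exists>U\<in>\<U>. K \<subseteq> U"
  shows "\<U> \<in> k_covers X"
  using assms unfolding k_covers_hitting by (rule hittingI)

lemma proper_opens_Inter:
  assumes "finite \<F>" "\<F> \<noteq> {}" "\<F> \<subseteq> proper_opens X" "K \<in> compacts X" "\<And>U. U \<in> \<F> \<Longrightarrow> K \<subseteq> U"
  shows "\<Inter>\<F> \<in> proper_opens X"
proof -
  have "openin X (\<Inter>\<F>)"
    using assms(1-3) by (intro openin_Inter) (auto simp: proper_opens_def)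
  moreover have "\<Inter>\<F> \<noteq> {}"
    using assms(4,5) by (fastforce simp: compacts_def)
  moreover obtain U where U: "U \<in> \<F>"
    using assms(2) by blast
  then have "U \<subset> topspace X"
    using assms(3) by (intro proper_opens_subset) auto
  then have "\<Inter>\<F> \<noteq> topspace X"
    using U by blast
  ultimately show ?thesis
    by (simp add: proper_opens_def)
qed

text \<open>Intersections of members of different covers may be empty, hence improper; taking all proper
  open sets inside some member of each cover avoids this.\<close>

lemma k_covers_common_refinement:
  assumes "finite I" "I \<noteq> {}" "\<And>i. i \<in> I \<Longrightarrow> \<U> i \<in> k_covers X"
  shows "{W \<in> proper_opens X. \<forall>i\<in>I. \<exists>U\<in>\<U> i. W \<subseteq> U} \<in> k_covers X"
proof (rule k_coversI)
  fix K assume K: "K \<in> compacts X"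
  then have "\<forall>i\<in>I. \<exists>U\<in>\<U> i. K \<subseteq> U"
    using assms(3) unfolding k_covers_def by blast
  then obtain u where u: "\<forall>i\<in>I. u i \<in> \<U> i \<and> K \<subseteq> u i"
    by metis
  have "u ` I \<subseteq> proper_opens X"
    using u assms(3) unfolding k_covers_def by fast
  then have "\<Inter>(u ` I) \<in> proper_opens X"
    using assms(1,2) K u by (intro proper_opens_Inter[where K = K]) auto
  then show "\<exists>W\<in>{W \<in> proper_opens X. \<forall>i\<in>I. \<exists>U\<in>\<U> i. W \<subseteq> U}. K \<subseteq> W"
    using u by (intro bexI[of _ "\<Inter>(u ` I)"]) auto
qed auto

text \<open>The Hurewicz-type consequence of the selection principle. Let \<open>a n\<close> be selected from a common
  refinement of the first \<open>n + 1\<close> covers so that \<open>range a\<close> is groupable. A group consisting of sets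
  selected at stages \<open>\<ge> j\<close> refines \<open>\<U> j\<close>, and all but finitely many groups are of this kind; enlarging
  the members of such a group to members of \<open>\<U> j\<close> gives \<open>F j\<close>.\<close>

lemma S1_gp_k_covers_imp_finite_selection:
  assumes S: "S1 (k_covers X) (gp (k_covers X))" and \<U>: "\<And>n::nat. \<U> n \<in> k_covers X"
  obtains F where "\<And>n. finite (F n)" "\<And>n. F n \<subseteq> \<U> n"
    "\<And>K. K \<in> compacts X \<Longrightarrow> finite {n. \<not> (\<exists>U\<in>F n. K \<subseteq> U)}"
proof -
  define \<V> where "\<V> n = {W \<in> proper_opens X. \<forall>i\<in>{..n}. \<exists>U\<in>\<U> i. W \<subseteq> U}" for n
  have "\<V> n \<in> k_covers X" for n
    unfolding \<V>_def using \<U> by (intro k_covers_common_refinement) auto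
  then obtain a where a: "\<And>n. a n \<in> \<V> n" and "range a \<in> gp (k_covers X)"
    using S[unfolded S1_def, rule_format, of \<V>] by blast
  then obtain \<phi> :: "'a set \<Rightarrow> nat" where fin: "\<And>m. finite {c \<in> range a. \<phi> c = m}"
    and J: "\<forall>J. infinite J \<longrightarrow> (\<Union>n\<in>J. {c \<in> range a. \<phi> c = n}) \<in> k_covers X"
    unfolding gp_def groupable_def by blast
  have ev: "finite {m. \<not> (\<exists>c\<in>{c \<in> range a. \<phi> c = m}. K \<subseteq> c)}" if "K \<in> compacts X" for K
    by (rule groupable_hitting_eventually[OF J[unfolded k_covers_hitting] that])
  \<comment> \<open>The groups are disjoint, so only finitely many of them meet the first \<open>j\<close> selections.\<close>
  have "\<exists>m\<ge>j. \<forall>c \<in> {c \<in> range a. \<phi> c = m}. j \<le> inv a c" for j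
  proof -
    obtain b where b: "\<forall>m \<in> (\<lambda>n. \<phi> (a n)) ` {..<j}. m < b"
      using finite_nat_set_iff_bounded by blast
    have "j \<le> inv a c" if "c \<in> range a" "\<phi> c = max b j" for c
    proof (rule ccontr)
      assume "\<not> j \<le> inv a c"
      then have "\<phi> (a (inv a c)) < b"
        using b by simp
      then show False
        using that f_inv_into_f[OF that(1)] by simp
    qed
    then show ?thesis
      by (intro exI[of _ "max b j"]) auto
  qed
  then obtain m where m: "\<And>j. m j \<ge> j"
    "\<And>j c. c \<in> range a \<Longrightarrow> \<phi> c = m j \<Longrightarrow> j \<le> inv a c"
    by (simp, metis)
  have "\<exists>U\<in>\<U> j. c \<subseteq> U" if "c \<in> range a" "\<phi> c = m j" for j c
    using a[of "inv a c"] m(2)[OF that] f_inv_into_f[OF that(1)] unfolding \<V>_def by simp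
  then have "\<exists>h. \<forall>j c. c \<in> range a \<longrightarrow> \<phi> c = m j \<longrightarrow> h j c \<in> \<U> j \<and> c \<subseteq> h j c"
    by (intro choice allI) blast
  then obtain h where h: "\<And>j c. c \<in> range a \<Longrightarrow> \<phi> c = m j \<Longrightarrow> h j c \<in> \<U> j \<and> c \<subseteq> h j c"
    by blast
  show thesis
  proof (rule that[of "\<lambda>j. h j ` {c \<in> range a. \<phi> c = m j}"])
    fix K assume "K \<in> compacts X"
    then obtain b where b: "\<forall>n \<in> {m. \<not> (\<exists>c\<in>{c \<in> range a. \<phi> c = m}. K \<subseteq> c)}. n < b"
      using ev finite_nat_set_iff_bounded by blast
    have "\<exists>U\<in>h j ` {c \<in> range a. \<phi> c = m j}. K \<subseteq> U" if "j \<ge> b" for j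
    proof -
      have "\<not> m j < b"
        using m(1)[of j] that by simp
      with b obtain c where "c \<in> range a" "\<phi> c = m j" "K \<subseteq> c"
        by blast
      then show ?thesis
        using h[of c j] by blast
    qed
    then have "{j. \<not> (\<exists>U\<in>h j ` {c \<in> range a. \<phi> c = m j}. K \<subseteq> U)} \<subseteq> {..<b}"
      using not_le by blast
    then show "finite {j. \<not> (\<exists>U\<in>h j ` {c \<in> range a. \<phi> c = m j}. K \<subseteq> U)}"
      by (rule finite_subset) simp
  qed (use fin h in auto)
qed

lemma k_covers_countable_gp:
  assumes "S1 (k_covers X) (gp (k_covers X))" "\<U> \<in> k_covers X" "countable \<U>"
  shows "\<U> \<in> gp (k_covers X)"
  using assms S1_gp_hitting_iff[of "proper_opens X" "compacts X" "\<lambda>K U. K \<subseteq> U"]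
  by (simp add: gp_def k_covers_hitting)

text \<open>Against any strategy of One, a play won by Two is found as a branch of the pruned tree
  described at the beginning.\<close>

lemma S1_gp_k_covers_imp_not_winning:
  assumes S: "S1 (k_covers X) (gp (k_covers X))"
  shows "\<not> winning_strategy_One (k_covers X) (gp (k_covers X)) \<sigma>"
proof
  assume win: "winning_strategy_One (k_covers X) (gp (k_covers X)) \<sigma>"
  let ?pos = "lists (\<Union>(k_covers X))"
  have \<sigma>: "\<sigma> s \<in> k_covers X" if "s \<in> ?pos" for s
    using win that unfolding winning_strategy_One_def strategy_One_def by blast
  \<comment> \<open>Two only answers inside countable subcovers, so that the relevant positions are countably many.\<close>
  have "\<forall>s\<in>?pos. \<exists>a::nat \<Rightarrow> 'a set. range a \<subseteq> \<sigma> s \<and> range a \<in> k_covers X"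
  proof
    fix s assume "s \<in> ?pos"
    then obtain a where "\<forall>n::nat. a n \<in> \<sigma> s" "range a \<in> gp (k_covers X)"
      using S[unfolded S1_def, rule_format, of "\<lambda>_. \<sigma> s"] \<sigma> by blast
    then show "\<exists>a::nat \<Rightarrow> 'a set. range a \<subseteq> \<sigma> s \<and> range a \<in> k_covers X"
      unfolding gp_def by blast
  qed
  then obtain c :: "'a set list \<Rightarrow> nat \<Rightarrow> 'a set" where
    c: "\<And>s. s \<in> ?pos \<Longrightarrow> range (c s) \<subseteq> \<sigma> s" "\<And>s. s \<in> ?pos \<Longrightarrow> range (c s) \<in> k_covers X"
    by metis
  \<comment> \<open>Positions are coded by lists of the indices of Two's answers.\<close>
  define p where "p = foldl (\<lambda>s i. s @ [c s i]) []"
  have p_Nil: "p [] = []" and p_snoc: "p (t @ [i]) = p t @ [c (p t) i]" for t i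
    by (simp_all add: p_def)
  have p_pos: "p t \<in> ?pos" for t
  proof (induction t rule: rev_induct)
    case (snoc i t)
    have "c (p t) i \<in> \<Union>(k_covers X)"
      using c(2)[OF snoc] by blast
    with snoc show ?case
      by (simp add: p_snoc)
  qed (simp add: p_Nil)
  define U where "U t i = c (p t) i" for t i
  have U: "range (U t) \<in> k_covers X" "U t i \<in> \<sigma> (p t)" for t i
    unfolding U_def using c p_pos by blast+
  have Uprop: "U t i \<in> proper_opens X" for t i
    using U(1)[of t] unfolding k_covers_def by blast
  obtain F where F: "\<And>n. finite (F n)" "\<And>n. F n \<subseteq> range (U (from_nat n))"
    "\<And>K. K \<in> compacts X \<Longrightarrow> finite {n. \<not> (\<exists>V\<in>F n. K \<subseteq> V)}"
    using S1_gp_k_covers_imp_finite_selection[OF S, of "\<lambda>n. range (U (from_nat n))"] U(1) by blast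
  \<comment> \<open>The bound is made positive so that every position of the pruned tree has a successor.\<close>
  have "\<exists>g>0. F (to_nat t) \<subseteq> U t ` {..<g}" for t :: "nat list"
  proof -
    obtain I where I: "finite I" "F (to_nat t) = U t ` I"
      using F(1,2)[of "to_nat t"] finite_subset_image[of "F (to_nat t)" "U t" UNIV] by auto
    obtain k where "\<forall>i\<in>I. i < k"
      using I(1) finite_nat_set_iff_bounded by blast
    with I(2) show ?thesis
      by (intro exI[of _ "Suc k"]) (auto intro: less_SucI)
  qed
  then obtain g where g: "\<And>t. g t > 0" "\<And>t. F (to_nat t) \<subseteq> U t ` {..<g t}"
    by metis
  have catch: "finite {t. \<not> (\<exists>i<g t. K \<subseteq> U t i)}" if "K \<in> compacts X" for K
  proof -
    have "finite (to_nat -` {n. \<not> (\<exists>V\<in>F n. K \<subseteq> V)} :: nat list set)"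
      using F(3)[OF that] by (intro finite_vimageI) auto
    moreover have "{t. \<not> (\<exists>i<g t. K \<subseteq> U t i)} \<subseteq> to_nat -` {n. \<not> (\<exists>V\<in>F n. K \<subseteq> V)}"
      using g(2) by fastforce
    ultimately show ?thesis
      by (rule rev_finite_subset)
  qed
  \<comment> \<open>The levels of the pruned tree.\<close>
  define L where "L = rec_nat {[]} (\<lambda>_ A. \<Union>t\<in>A. (\<lambda>i. t @ [i]) ` {..<g t})"
  have L_0: "L 0 = {[]}" and L_Suc: "L (Suc n) = (\<Union>t\<in>L n. (\<lambda>i. t @ [i]) ` {..<g t})" for n
    by (simp_all add: L_def)
  have L: "finite (L n)" "L n \<noteq> {}" "\<forall>t\<in>L n. length t = n" for n
  proof (induction n)
    case (Suc n)
    case 2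
    show ?case
      using Suc(2) g(1) by (auto simp: L_Suc)
  qed (auto simp: L_0 L_Suc)
  \<comment> \<open>The \<open>k\<close>-th cover uses only the levels \<open>prod_encode (k, j)\<close>; the covers therefore never compete for
    a level, and on each level one choice of answers suffices.\<close>
  define \<W> where "\<W> k = {W \<in> proper_opens X. \<exists>j. \<forall>t\<in>L (prod_encode (k, j)). \<exists>i<g t. W \<subseteq> U t i}" for k
  have "\<W> k \<in> k_covers X" for k
  proof (rule k_coversI)
    fix K assume K: "K \<in> compacts X"
    \<comment> \<open>Beyond level \<open>b\<close> no position fails to catch \<open>K\<close>.\<close>
    obtain b where b: "\<forall>n \<in> length ` {t. \<not> (\<exists>i<g t. K \<subseteq> U t i)}. n < b"
      using catch[OF K] finite_nat_set_iff_bounded by blast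
    let ?n = "prod_encode (k, b)"
    have "\<exists>i<g t. K \<subseteq> U t i" if t: "t \<in> L ?n" for t
    proof -
      have "\<not> length t < b"
        using L(3) t le_prod_encode_2[of b k] by force
      then show ?thesis
        using b by blast
    qed
    then obtain \<tau> where \<tau>: "\<And>t. t \<in> L ?n \<Longrightarrow> \<tau> t < g t \<and> K \<subseteq> U t (\<tau> t)"
      by metis
    let ?W = "\<Inter>((\<lambda>t. U t (\<tau> t)) ` L ?n)"
    have "?W \<in> proper_opens X"
      using L(1,2) \<tau> Uprop K by (intro proper_opens_Inter[where K = K]) auto
    then have "?W \<in> \<W> k"
      unfolding \<W>_def using \<tau> by blast
    moreover have "K \<subseteq> ?W"
      using \<tau> by blast
    ultimately show "\<exists>W\<in>\<W> k. K \<subseteq> W" ..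
  qed (auto simp: \<W>_def)
  then obtain W where W: "\<And>k. W k \<in> \<W> k" "range W \<in> gp (k_covers X)"
    using S[unfolded S1_def, rule_format, of \<W>] by blast
  then have "\<forall>k. \<exists>j. \<forall>t\<in>L (prod_encode (k, j)). \<exists>i<g t. W k \<subseteq> U t i"
    unfolding \<W>_def by blast
  then obtain j where j: "\<And>k t. t \<in> L (prod_encode (k, j k)) \<Longrightarrow> \<exists>i<g t. W k \<subseteq> U t i"
    by metis
  \<comment> \<open>On levels that no inning has selected, any answer below the bound will do.\<close>
  have "\<exists>i<g t. \<forall>k. n = prod_encode (k, j k) \<longrightarrow> W k \<subseteq> U t i" if "t \<in> L n" for n t
  proof (cases "\<exists>k. n = prod_encode (k, j k)")
    case True
    then show ?thesis
      using j that by auto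
  next
    case False
    then show ?thesis
      using g(1) by blast
  qed
  then have "\<exists>\<tau>. \<forall>n t. t \<in> L n \<longrightarrow> \<tau> n t < g t \<and> (\<forall>k. n = prod_encode (k, j k) \<longrightarrow> W k \<subseteq> U t (\<tau> n t))"
    by (intro choice allI) blast
  then obtain \<tau> where \<tau>: "\<And>n t. t \<in> L n \<Longrightarrow> \<tau> n t < g t"
    "\<And>n t k. t \<in> L n \<Longrightarrow> n = prod_encode (k, j k) \<Longrightarrow> W k \<subseteq> U t (\<tau> n t)"
    by blast
  \<comment> \<open>The branch that Two follows, and the resulting play \<open>x\<close>.\<close>
  define b where "b = rec_nat [] (\<lambda>n t. t @ [\<tau> n t])"
  have b_0: "b 0 = []" and b_Suc: "b (Suc n) = b n @ [\<tau> n (b n)]" for n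
    by (simp_all add: b_def)
  have bL: "b n \<in> L n" for n
  proof (induction n)
    case (Suc n)
    then show ?case
      using \<tau>(1)[OF Suc] unfolding b_Suc L_Suc by blast
  qed (simp add: b_0 L_0)
  define x where "x n = U (b n) (\<tau> n (b n))" for n
  have pb: "p (b n) = map x [0..<n]" for n
    by (induction n) (auto simp: b_0 b_Suc p_Nil p_snoc x_def U_def)
  have "x n \<in> \<sigma> (map x [0..<n])" for n
    using U(2)[of "b n"] by (simp add: x_def pb)
  then have "range x \<notin> gp (k_covers X)"
    using win unfolding winning_strategy_One_def by blast
  moreover have "range x \<in> k_covers X"
  proof (rule k_coversI)
    show "range x \<subseteq> proper_opens X"
      using Uprop by (auto simp: x_def)
    fix K assume "K \<in> compacts X"
    then obtain k where "K \<subseteq> W k"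
      using W(2) unfolding gp_def k_covers_def by blast
    then have "K \<subseteq> x (prod_encode (k, j k))"
      using \<tau>(2)[OF bL] unfolding x_def by blast
    then show "\<exists>V\<in>range x. K \<subseteq> V"
      by blast
  qed
  ultimately show False
    using k_covers_countable_gp[OF S] by simp
qed

text \<open>A sequence witnessing the failure of \<open>S\<^sub>1\<close> is a winning strategy that ignores the moves of
  Two.\<close>

lemma S1_if_no_winning_strategy:
  fixes \<A> \<B> :: "'b set set"
  assumes "\<not> (\<exists>\<sigma>. winning_strategy_One \<A> \<B> \<sigma>)"
  shows "S1 \<A> \<B>"
  unfolding S1_def
proof (intro allI impI, rule ccontr)
  fix \<U> :: "nat \<Rightarrow> 'b set"
  assume \<U>: "\<forall>n. \<U> n \<in> \<A>" and no: "\<not> (\<exists>a. (\<forall>n. a n \<in> \<U> n) \<and> range a \<in> \<B>)"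
  have "winning_strategy_One \<A> \<B> (\<lambda>s. \<U> (length s))"
    using \<U> no unfolding winning_strategy_One_def strategy_One_def by auto
  with assms show False by blast
qed

section \<open>The equivalence\<close>

theorem theorem50:
  fixes X :: "'a topology"
  assumes "tychonoff_space X"
    and "\<not> compact_space X"
  shows "(S1 (k_covers X) (gp (k_covers X))
            \<longleftrightarrow> \<not> (\<exists>\<sigma>. winning_strategy_One (k_covers X) (gp (k_covers X)) \<sigma>))
       \<and> (\<not> (\<exists>\<sigma>. winning_strategy_One (k_covers X) (gp (k_covers X)) \<sigma>)
            \<longleftrightarrow> Reznichenko (Ck X) \<and> countable_strong_fan_tightness (Ck X))
       \<and> (Reznichenko (Ck X) \<and> countable_strong_fan_tightness (Ck X)
            \<longleftrightarrow> S1 (Omega (Ck X) (zero_fun X)) (gp (Omega (Ck X) (zero_fun X))))"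
proof -
  have cr: "completely_regular_space X" and t1: "t1_space X"
    using assms(1) Hausdorff_imp_t1_space by (auto simp: tychonoff_space_def)
  have ne: "topspace X \<noteq> {}"
    using assms(2) compactin_empty[of X] unfolding compact_space_def by metis
  have game: "S1 (k_covers X) (gp (k_covers X))
      \<longleftrightarrow> \<not> (\<exists>\<sigma>. winning_strategy_One (k_covers X) (gp (k_covers X)) \<sigma>)"
    using S1_gp_k_covers_imp_not_winning S1_if_no_winning_strategy by blast
  have "S1 (k_covers X) (gp (k_covers X)) \<Longrightarrow> \<forall>z\<in>cfuns X. S1 (Omega (Ck X) z) (gp (Omega (Ck X) z))"
    using S1_gp_k_covers_imp_Omega[OF t1 assms(2)] by blast
  moreover have "\<forall>z\<in>cfuns X. S1 (Omega (Ck X) z) (gp (Omega (Ck X) z))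
      \<Longrightarrow> S1 (Omega (Ck X) (zero_fun X)) (gp (Omega (Ck X) (zero_fun X)))"
    using zero_fun_cfuns by blast
  ultimately show ?thesis
    using game S1_gp_Omega_imp_k_covers[OF cr ne] S1_gp_Omega_iff_Reznichenko[OF ne] by blast
qed

end
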